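(* Let $v\in\mathbb{R}^n$ and $N\in\{1,\dots,n-1\}$ be such that $v_l>0$ for $l\in\{1,\dots,N\}$ and $v_r<0$ for $r\in\{N+1,\dots,n\}$. Let $\mathcal{I}_N:=\{1,\dots,N\}\times\{N+1,\dots,n\}$. Then the polyhedral cone $P:=\operatorname{span}\{v\}\oplus[0,\infty)^n$ has the inequality description $$ P=\bigcap_{(l,r)\in\mathcal{I}_N}\left\{x\in\mathbb{R}^n:\frac{x_l}{v_l}\ge\frac{x_r}{v_r}\right\}. $$ Moreover, every inequality in this description of $P$ is facet-defining, i.e. for each $(l,r)\in\mathcal{I}_N$ the set $\{x\in P: x_l/v_l=x_r/v_r\}$ is a facet of $P$.
   Context: $A\oplus B:=\{a+b:a\in A,b\in B\}$ denotes the Minkowski sum, so $P=\{\lambda v+u:\lambda\in\mathbb{R},u\in[0,\infty)^n\}$. *)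

theory Defs
  imports "HOL-Analysis.Analysis" "HOL-Library.Set_Algebras"
begin

definition nonneg_orthant :: "(real ^ 'n) set" where
  "nonneg_orthant = {u. \<forall>i. 0 \<le> u $ i}"

text \<open>Here \<open>+\<close> is the Minkowski sum of sets from \<^theory>\<open>HOL-Library.Set_Algebras\<close>.\<close>

definition span_orthant_cone :: "real ^ 'n \<Rightarrow> (real ^ 'n) set" where
  "span_orthant_cone v = span {v} + nonneg_orthant"

definition sign_pairs :: "nat \<Rightarrow> nat \<Rightarrow> (nat \<times> nat) set" where
  "sign_pairs n N = {1..N} \<times> {N + 1..n}"

end

theory Submission
  imports Defs
begin

text \<open>A point \<open>x\<close> lies in \<open>span {v} + nonneg_orthant\<close> iff some scalar \<open>c\<close> satisfies
  \<open>c v\<^sub>i \<le> x\<^sub>i\<close> for all \<open>i\<close>, that is, iff \<open>c\<close> separates the ratios \<open>x\<^sub>i / v\<^sub>i\<close> with \<open>v\<^sub>i < 0\<close>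
  from those with \<open>v\<^sub>i > 0\<close>; this gives the inequality description. For fixed \<open>(i, j)\<close>, the
  point with entries \<open>0\<close> at \<open>i, j\<close> and \<open>1\<close> elsewhere satisfies that inequality with equality and
  all others strictly. Near it, the face agrees with a hyperplane, so it has codimension one.\<close>

lemma mem_span_orthant_cone_iff:
  "x \<in> span_orthant_cone v \<longleftrightarrow> (\<exists>c. \<forall>i. c * v $ i \<le> x $ i)"
proof
  assume "x \<in> span_orthant_cone v"
  then obtain c u where "x = c *\<^sub>R v + u" "u \<in> nonneg_orthant"
    by (auto simp: span_orthant_cone_def set_plus_def span_singleton)
  then show "\<exists>c. \<forall>i. c * v $ i \<le> x $ i"
    by (auto simp: nonneg_orthant_def intro!: exI[of _ c])
next
  assume "\<exists>c. \<forall>i. c * v $ i \<le> x $ i"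
  then obtain c where "\<forall>i. c * v $ i \<le> x $ i" ..
  then have "x - c *\<^sub>R v \<in> nonneg_orthant"
    by (simp add: nonneg_orthant_def)
  moreover have "c *\<^sub>R v \<in> span {v}"
    by (simp add: span_mul span_base)
  ultimately show "x \<in> span_orthant_cone v"
    unfolding span_orthant_cone_def set_plus_def by force
qed

lemma cone_span_orthant_cone: "cone (span_orthant_cone v)"
  unfolding cone_def
proof (intro ballI allI impI)
  fix x and t :: real
  assume "x \<in> span_orthant_cone v" and t: "0 \<le> t"
  then obtain c where "\<forall>i. c * v $ i \<le> x $ i"
    by (auto simp: mem_span_orthant_cone_iff)
  with t have "\<forall>i. (t * c) * v $ i \<le> (t *\<^sub>R x) $ i"
    by (simp add: mult.assoc mult_left_mono)
  then show "t *\<^sub>R x \<in> span_orthant_cone v"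
    unfolding mem_span_orthant_cone_iff by blast
qed

lemma span_orthant_cone_eq_ratios:
  fixes v :: "real ^ 'n"
  assumes nz: "\<And>i. v $ i \<noteq> 0" and neg: "v $ k < 0"
  shows "span_orthant_cone v =
    (\<Inter>(i, j)\<in>{i. 0 < v $ i} \<times> {j. v $ j < 0}. {x. x $ i / v $ i \<ge> x $ j / v $ j})"
    (is "_ = ?R")
proof (intro set_eqI)
  fix x
  show "x \<in> span_orthant_cone v \<longleftrightarrow> x \<in> ?R"
  proof
    assume "x \<in> span_orthant_cone v"
    then obtain c where c: "\<And>i. c * v $ i \<le> x $ i"
      by (auto simp: mem_span_orthant_cone_iff)
    have "x $ j / v $ j \<le> x $ i / v $ i" if "0 < v $ i" "v $ j < 0" for i j
    proof (rule order_trans)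
      show "x $ j / v $ j \<le> c" using c[of j] that by (simp add: divide_le_eq)
      show "c \<le> x $ i / v $ i" using c[of i] that by (simp add: le_divide_eq)
    qed
    then show "x \<in> ?R" by auto
  next
    assume x: "x \<in> ?R"
    \<comment> \<open>This is the least scalar satisfying \<open>c * v $ j <= x $ j\<close> at every
      negative coordinate; \<open>neg\<close> makes the finite set under \<open>Max\<close>
      nonempty.\<close>
    define c where "c = Max ((\<lambda>j. x $ j / v $ j) ` {j. v $ j < 0})"
    have "c * v $ i \<le> x $ i" for i
    proof (cases "0 < v $ i")
      case True
      have "c \<le> x $ i / v $ i"
        unfolding c_def using x neg True by (subst Max_le_iff) auto
      then show ?thesis using True by (simp add: le_divide_eq)
    next
      case False
      then have "v $ i < 0" using nz[of i] by linarith
      moreover from this have "x $ i / v $ i \<le> c"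
        unfolding c_def by (intro Max_ge) auto
      ultimately show ?thesis by (simp add: divide_le_eq)
    qed
    then show "x \<in> span_orthant_cone v"
      unfolding mem_span_orthant_cone_iff by blast
  qed
qed

text \<open>Encodes the comparison of two ratios as the sign of an inner product, so that facts on
  halfspaces and hyperplanes apply.\<close>

definition ratio_normal :: "real ^ 'n \<Rightarrow> 'n \<Rightarrow> 'n \<Rightarrow> real ^ 'n" where
  "ratio_normal v i j = axis i (inverse (v $ i)) - axis j (inverse (v $ j))"

lemma inner_ratio_normal: "ratio_normal v i j \<bullet> x = x $ i / v $ i - x $ j / v $ j"
  by (simp add: ratio_normal_def inner_diff_left inner_axis' divide_inverse_commute)

lemma polyhedron_span_orthant_cone:
  fixes v :: "real ^ 'n"
  assumes "\<And>i. v $ i \<noteq> 0" and "v $ k < 0"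
  shows "polyhedron (span_orthant_cone v)"
proof -
  have "polyhedron {x. x $ i / v $ i \<ge> x $ j / v $ j}" for i j
    using polyhedron_halfspace_ge[of 0 "ratio_normal v i j"] by (simp add: inner_ratio_normal)
  then show ?thesis
    unfolding span_orthant_cone_eq_ratios[OF assms] by (intro polyhedron_Inter) auto
qed

lemma facet_span_orthant_cone:
  fixes v :: "real ^ 'n"
  assumes nz: "\<And>i. v $ i \<noteq> 0" and i: "0 < v $ i" and j: "v $ j < 0"
  shows "{x \<in> span_orthant_cone v. x $ i / v $ i = x $ j / v $ j} facet_of span_orthant_cone v"
    (is "?F facet_of ?P")
proof -
  define H where "H = {x. ratio_normal v i j \<bullet> x = 0}"
  \<comment> \<open>\<open>T\<close> keeps every inequality strict but drops the pair
    \<open>(i, j)\<close>, so it is open and can still meet \<open>H\<close>. Restoring the strict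
    \<open>(i, j)\<close> inequality gives an open set \<open>U\<close> inside the cone.\<close>
  define T where "T = (\<Inter>(k, m)\<in>{k. 0 < v $ k} \<times> {m. v $ m < 0} - {(i, j)}.
    {x. x $ k / v $ k > x $ m / v $ m})"
  define U where "U = T \<inter> {x. x $ i / v $ i > x $ j / v $ j}"
  have strict: "x $ m / v $ m < x $ k / v $ k"
    if "x \<in> T" "0 < v $ k" "v $ m < 0" "(k, m) \<noteq> (i, j)" for x k m
    using that by (force simp: T_def)
  have ij: "i \<noteq> j" using i j by auto
  have F_eq: "?F = ?P \<inter> H"
    by (auto simp: H_def inner_ratio_normal)
  note P_eq = span_orthant_cone_eq_ratios[OF nz j]
  have "ratio_normal v i j \<bullet> axis i 1 \<noteq> 0"
    using ij nz[of i] by (simp add: inner_ratio_normal axis_def)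
  then have normal: "ratio_normal v i j \<noteq> 0" by auto
  have open_ratio: "open {x. x $ k / v $ k > x $ m / v $ m}" for k m
    using open_halfspace_gt[of 0 "ratio_normal v k m"] by (simp add: inner_ratio_normal)
  have "open T"
    unfolding T_def using open_ratio by (intro open_INT) auto
  then have "open U"
    unfolding U_def using open_ratio by (intro open_Int)
  have TF: "H \<inter> T \<subseteq> ?F"
  proof
    fix x
    assume x: "x \<in> H \<inter> T"
    have "x $ m / v $ m \<le> x $ k / v $ k" if "0 < v $ k" "v $ m < 0" for k m
      using x that by (cases "(k, m) = (i, j)")
        (auto simp: H_def inner_ratio_normal intro!: less_imp_le strict)
    with x show "x \<in> ?F"
      unfolding F_eq by (auto simp: P_eq)
  qed
  have UP: "U \<subseteq> ?P"
  proof
    fix x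
    assume x: "x \<in> U"
    have "x $ m / v $ m \<le> x $ k / v $ k" if "0 < v $ k" "v $ m < 0" for k m
      using x that by (cases "(k, m) = (i, j)") (auto simp: U_def intro!: less_imp_le strict)
    then show "x \<in> ?P"
      by (auto simp: P_eq)
  qed
  \<comment> \<open>Zero separates the ratios of the all-ones vector by sign.\<close>
  have ratio1: "1 / v $ m < 1 / v $ k" if "0 < v $ k" "v $ m < 0" for k m
    by (rule less_trans[of _ 0]) (use that in auto)
  \<comment> \<open>Both ratios at \<open>i\<close> and \<open>j\<close> vanish, which gives
    membership in \<open>H\<close>. Any other pair has an entry 1 at a coordinate outside
    \<open>{i, j}\<close>, so at least one of its two ratios is nonzero, with the sign that makes
    the inequality strict.\<close>
  have "(\<chi> k. if k = i \<or> k = j then 0 else 1) \<in> H \<inter> T"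
    using i j by (auto simp: H_def T_def inner_ratio_normal ratio1 split: if_splits)
  then have ne: "H \<inter> T \<noteq> {}" by blast
  \<comment> \<open>A nonempty open subset forces the cone to have full dimension.\<close>
  have "(\<chi> k. 1) \<in> U"
    using i j by (auto simp: U_def T_def ratio1)
  then have "aff_dim ?P = int CARD('n)"
    using aff_dim_open[OF \<open>open U\<close>] aff_dim_subset[OF UP] aff_dim_le_DIM[of ?P] by fastforce
  \<comment> \<open>The face is squeezed between \<open>H \<inter> T\<close> and \<open>H\<close>.
    These have equal affine dimension, since intersecting a convex set with an open set that meets
    it preserves the dimension.\<close>
  moreover have "aff_dim ?F = int CARD('n) - 1"
  proof (rule antisym)
    have "convex H" unfolding H_def by (rule convex_hyperplane)
    then have "aff_dim (H \<inter> T) = aff_dim H"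
      using aff_dim_convex_Int_open[OF _ \<open>open T\<close> ne] by blast
    moreover have H: "aff_dim H = int CARD('n) - 1"
      unfolding H_def using normal by (simp add: aff_dim_hyperplane)
    ultimately show "int CARD('n) - 1 \<le> aff_dim ?F"
      using aff_dim_subset[OF TF] by simp
    show "aff_dim ?F \<le> int CARD('n) - 1"
      using aff_dim_subset[of ?F H] H F_eq by simp
  qed
  \<comment> \<open>The \<open>(i, j)\<close> inequality says that the functional is nonnegative on
    the cone, so \<open>H\<close> is a supporting hyperplane.\<close>
  moreover have "?F face_of ?P"
    unfolding F_eq H_def
  proof (rule face_of_Int_supporting_hyperplane_ge)
    show "convex ?P"
      using polyhedron_span_orthant_cone[OF nz j] by (rule polyhedron_imp_convex)
    show "ratio_normal v i j \<bullet> x \<ge> 0" if "x \<in> ?P" for x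
      using that i j by (auto simp: P_eq inner_ratio_normal)
  qed
  ultimately show ?thesis
    unfolding facet_of_def using TF ne by auto
qed

theorem theorem5:
  fixes v :: "real ^ 'n"
    and e :: "nat \<Rightarrow> 'n"
    and N :: nat
  assumes "bij_betw e {1..CARD('n)} (UNIV :: 'n set)"
    and "N \<in> {1..CARD('n) - 1}"
    and "\<And>l. l \<in> {1..N} \<Longrightarrow> v $ e l > 0"
    and "\<And>r. r \<in> {N + 1..CARD('n)} \<Longrightarrow> v $ e r < 0"
  shows "polyhedron (span_orthant_cone v) \<and> cone (span_orthant_cone v)
    \<and> span_orthant_cone v =
        (\<Inter>(l, r)\<in>sign_pairs CARD('n) N. {x. x $ e l / v $ e l \<ge> x $ e r / v $ e r})
    \<and> (\<forall>(l, r)\<in>sign_pairs CARD('n) N.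
          {x \<in> span_orthant_cone v. x $ e l / v $ e l = x $ e r / v $ e r}
            facet_of span_orthant_cone v)"
proof -
  have split: "{1..CARD('n)} = {1..N} \<union> {N + 1..CARD('n)}"
    using assms(2) by auto
  have range: "e ` ({1..N} \<union> {N + 1..CARD('n)}) = UNIV"
    using assms(1) unfolding bij_betw_def split by blast
  have cases: "(\<exists>l\<in>{1..N}. i = e l) \<or> (\<exists>r\<in>{N + 1..CARD('n)}. i = e r)" for i
    using range by blast
  have nz: "v $ i \<noteq> 0" for i
    using cases[of i] assms(3,4) by (metis less_irrefl)
  \<comment> \<open>As \<open>N\<close> is at most \<open>CARD('n) - 1\<close>, the last index
    belongs to the negative block.\<close>
  have neg: "v $ e CARD('n) < 0"
    using assms(2) by (intro assms(4)) auto
  \<comment> \<open>The enumeration \<open>e\<close> carries the two index blocks exactly onto the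
    two sign classes, so pairs of opposite sign correspond to \<open>sign_pairs\<close>.\<close>
  have pos_eq: "{i. 0 < v $ i} = e ` {1..N}"
  proof (intro set_eqI iffI)
    fix i
    assume "i \<in> {i. 0 < v $ i}"
    then show "i \<in> e ` {1..N}"
      using cases[of i] assms(4) by (force dest: less_asym)
  qed (use assms(3) in auto)
  have neg_eq: "{i. v $ i < 0} = e ` {N + 1..CARD('n)}"
  proof (intro set_eqI iffI)
    fix i
    assume "i \<in> {i. v $ i < 0}"
    then show "i \<in> e ` {N + 1..CARD('n)}"
      using cases[of i] assms(3) by (force dest: less_asym)
  qed (use assms(4) in auto)
  have "span_orthant_cone v =
      (\<Inter>(l, r)\<in>sign_pairs CARD('n) N. {x. x $ e l / v $ e l \<ge> x $ e r / v $ e r})"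
    unfolding span_orthant_cone_eq_ratios[OF nz neg] pos_eq neg_eq sign_pairs_def by auto
  moreover have "{x \<in> span_orthant_cone v. x $ e l / v $ e l = x $ e r / v $ e r}
      facet_of span_orthant_cone v" if "(l, r) \<in> sign_pairs CARD('n) N" for l r
    using that assms(3,4) nz by (intro facet_span_orthant_cone) (auto simp: sign_pairs_def)
  ultimately show ?thesis
    using polyhedron_span_orthant_cone[OF nz neg] cone_span_orthant_cone by blast
qed

end
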